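(* Let $k\ge 2$ and let $\mathcal{F}=(V,\mathcal{E})$ be a $k$-uniform edge-maximal hypertree of order $n=|V|\ge k-1$. Then $$|\mathcal{E}|\ge \frac{1}{k(k-1)}\cdot\frac{n-k+1}{n-k+2}\binom{n}{k-1}.$$
   Context: A $k$-uniform hypergraph $\mathcal{H}=(V,\mathcal{E})$ consists of a finite vertex set $V$ and a set $\mathcal{E}$ of $k$-element subsets of $V$ (no multiple edges). A $k$-uniform hypergraph is a chain if there is a sequence $v_1,\dots,v_l$ of its vertices in which every vertex appears at least once (possibly more times), $v_1\ne v_l$, and its edge set consists of exactly the $l-k+1$ distinct sets $\{v_i,\dots,v_{i+k-1}\}$, $1\le i\le l-k+1$; it is a semicycle if the same holds with $v_1=v_l$ instead. $\mathcal{H}$ is chain-connected if every pair of distinct vertices is contained in some subhypergraph of $\mathcal{H}$ that is a chain; semicycle-free if no subhypergraph is a semicycle. A hypertree is a chain-connected, semicycle-free $k$-uniform hypergraph. An edge-maximal hypertree is a hypertree $(V,\mathcal{E})$ such that for every $k$-subset $e\subseteq V$ with $e\notin\mathcal{E}$, the hypergraph $(V,\mathcal{E}\cup\{e\})$ is not a hypertree. *)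

theory Defs
  imports Complex_Main
begin

definition uniform_hypergraph :: "nat \<Rightarrow> 'a set \<Rightarrow> 'a set set \<Rightarrow> bool" where
  "uniform_hypergraph k V E \<longleftrightarrow> finite V \<and> (\<forall>e\<in>E. e \<subseteq> V \<and> card e = k)"

definition subhypergraph :: "nat \<Rightarrow> 'a set \<Rightarrow> 'a set set \<Rightarrow> 'a set \<Rightarrow> 'a set set \<Rightarrow> bool" where
  "subhypergraph k V' E' V E \<longleftrightarrow> uniform_hypergraph k V' E' \<and> V' \<subseteq> V \<and> E' \<subseteq> E"

definition window :: "nat \<Rightarrow> 'a list \<Rightarrow> nat \<Rightarrow> 'a set" where
  "window k vs i = (\<lambda>j. vs ! j) ` {i..<i + k}"

text \<open>
  The sequence \<open>v\<^sub>1, \<dots>, v\<^sub>l\<close> is a list \<open>vs\<close> with 0-based indices, so the windows start at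
  the positions \<open>0, \<dots>, l - k\<close>. The condition \<open>l \<ge> k\<close> says that there is at least one window:
  without it, edgeless hypergraphs would count as chains and as semicycles. Injectivity on the
  start positions says that the \<open>l - k + 1\<close> windows are pairwise distinct.
\<close>
definition generates :: "nat \<Rightarrow> 'a list \<Rightarrow> 'a set \<Rightarrow> 'a set set \<Rightarrow> bool" where
  "generates k vs V E \<longleftrightarrow>
     k \<le> length vs \<and> set vs = V \<and>
     inj_on (window k vs) {0..length vs - k} \<and>
     E = window k vs ` {0..length vs - k}"

definition chain :: "nat \<Rightarrow> 'a set \<Rightarrow> 'a set set \<Rightarrow> bool" where
  "chain k V E \<longleftrightarrow> uniform_hypergraph k V E \<and> (\<exists>vs. generates k vs V E \<and> hd vs \<noteq> last vs)"

definition semicycle :: "nat \<Rightarrow> 'a set \<Rightarrow> 'a set set \<Rightarrow> bool" where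
  "semicycle k V E \<longleftrightarrow> uniform_hypergraph k V E \<and> (\<exists>vs. generates k vs V E \<and> hd vs = last vs)"

definition chain_connected :: "nat \<Rightarrow> 'a set \<Rightarrow> 'a set set \<Rightarrow> bool" where
  "chain_connected k V E \<longleftrightarrow>
     (\<forall>u\<in>V. \<forall>v\<in>V. u \<noteq> v \<longrightarrow>
        (\<exists>V' E'. subhypergraph k V' E' V E \<and> chain k V' E' \<and> u \<in> V' \<and> v \<in> V'))"

definition semicycle_free :: "nat \<Rightarrow> 'a set \<Rightarrow> 'a set set \<Rightarrow> bool" where
  "semicycle_free k V E \<longleftrightarrow> (\<nexists>V' E'. subhypergraph k V' E' V E \<and> semicycle k V' E')"

definition hypertree :: "nat \<Rightarrow> 'a set \<Rightarrow> 'a set set \<Rightarrow> bool" where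
  "hypertree k V E \<longleftrightarrow>
     uniform_hypergraph k V E \<and> chain_connected k V E \<and> semicycle_free k V E"

definition edge_maximal_hypertree :: "nat \<Rightarrow> 'a set \<Rightarrow> 'a set set \<Rightarrow> bool" where
  "edge_maximal_hypertree k V E \<longleftrightarrow>
     hypertree k V E \<and>
     (\<forall>e. e \<subseteq> V \<and> card e = k \<and> e \<notin> E \<longrightarrow> \<not> hypertree k V (E \<union> {e}))"

end

theory Submission
  imports Defs
begin

text \<open>
  If \<open>e\<close> is a non-edge, maximality gives a semicycle in \<open>E \<union> {e}\<close> through \<open>e\<close>; a semicycle has at
  least two windows, so \<open>e\<close> shares \<open>k - 1\<close> vertices with an edge next to it. Hence every
  \<open>k\<close>-subset of \<open>V\<close> contains a \<open>(k - 1)\<close>-set from the shadow of \<open>E\<close>. By de Caen's bound on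
  Turan numbers the shadow is large, and it has at most \<open>k |E|\<close> members.
\<close>

section \<open>Double counting and de Caen's bound\<close>

text \<open>The left side counts pairs \<open>(A, v)\<close> with \<open>A\<close> in
  \<open>H\<close> and \<open>v\<close> outside \<open>A\<close>. By \<open>K\<close> some
  \<open>w\<close> in \<open>A\<close> can be exchanged for \<open>v\<close> so that the result
  leaves \<open>H\<close>. With \<open>C = A - {w}\<close>, the vertex \<open>w\<close> extends
  \<open>C\<close> into \<open>H\<close> and \<open>v\<close> extends it out of \<open>H\<close>;
  the triple \<open>(C, w, v)\<close> determines \<open>(A, v)\<close>, since
  \<open>A = insert w C\<close>.\<close>

lemma card_mult_le_of_nbr:
  fixes H :: "'a set set"
  assumes "finite V"
    and H: "H \<subseteq> {A. A \<subseteq> V \<and> card A = Suc s}"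
    and K: "\<And>e. e \<subseteq> V \<Longrightarrow> card e = Suc (Suc s) \<Longrightarrow> \<exists>A. A \<subseteq> e \<and> card A = Suc s \<and> A \<notin> H"
  shows "card H * (card V - Suc s) \<le>
    (\<Sum>C | C \<subseteq> V \<and> card C = s.
      card {v \<in> V - C. insert v C \<in> H} * card {v \<in> V - C. insert v C \<notin> H})"
proof -
  let ?T = "SIGMA C:{C. C \<subseteq> V \<and> card C = s}.
    {v \<in> V - C. insert v C \<in> H} \<times> {v \<in> V - C. insert v C \<notin> H}"
  have finH: "finite H"
    by (rule finite_subset[OF H]) (simp add: assms(1))
  have finT: "finite ?T"
    using assms(1) by (intro finite_SigmaI finite_cartesian_product) auto
  have "\<exists>w. w \<in> A \<and> insert v (A - {w}) \<notin> H" if "A \<in> H" "v \<in> V - A" for A v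
  proof -
    have A: "A \<subseteq> V" "card A = Suc s" "finite A"
      using that H assms(1) by (auto intro: finite_subset)
    have "insert v A \<subseteq> V" "card (insert v A) = Suc (Suc s)"
      using A that by auto
    then obtain B where B: "B \<subseteq> insert v A" "card B = Suc s" "B \<notin> H"
      using K by blast
    have "card (insert v A - B) = 1"
      using B A that by (subst card_Diff_subset) (auto intro: finite_subset)
    then obtain w where w: "insert v A - B = {w}"
      by (auto simp: card_1_singleton_iff)
    have B_eq: "B = insert v A - {w}"
      using w B(1) by blast
    \<comment> \<open>Deleting \<open>v\<close> itself would give back \<open>A\<close>, which lies
      in \<open>H\<close>.\<close>
    have "w \<noteq> v"
      using B_eq B(3) that by auto
    then show ?thesis
      using w B_eq B(3) by (intro exI[of _ w]) (auto simp: insert_Diff_if)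
  qed
  then obtain w where w: "w A v \<in> A" "insert v (A - {w A v}) \<notin> H"
    if "A \<in> H" "v \<in> V - A" for A v
    by metis
  let ?f = "\<lambda>(A, v). (A - {w A v}, w A v, v)"
  have inj: "inj_on ?f (SIGMA A:H. V - A)"
  proof (rule inj_onI)
    fix p p'
    assume mem: "p \<in> (SIGMA A:H. V - A)" "p' \<in> (SIGMA A:H. V - A)" and eq: "?f p = ?f p'"
    obtain A v A' v' where p: "p = (A, v)" "p' = (A', v')"
      by (metis surj_pair)
    have "w A v \<in> A" "w A' v' \<in> A'"
      using w(1) mem p by auto
    moreover have "A - {w A v} = A' - {w A' v'}" "w A v = w A' v'" "v = v'"
      using eq p by auto
    ultimately show "p = p'"
      unfolding p by (metis insert_Diff)
  qed
  have sub: "?f ` (SIGMA A:H. V - A) \<subseteq> ?T"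
  proof (rule image_subsetI)
    fix p
    assume "p \<in> (SIGMA A:H. V - A)"
    then obtain A v where p: "p = (A, v)" and A: "A \<in> H" and v: "v \<in> V" "v \<notin> A"
      by auto
    have "A \<subseteq> V" "card A = Suc s" using A H by auto
    moreover have "w A v \<in> A" "insert v (A - {w A v}) \<notin> H" using w A v by auto
    ultimately show "?f p \<in> ?T"
      using A v p by (auto simp: insert_absorb)
  qed
  have "card H * (card V - Suc s) = (\<Sum>A\<in>H. card (V - A))"
  proof -
    have "card (V - A) = card V - Suc s" if "A \<in> H" for A
      using that H assms(1) by (subst card_Diff_subset) (auto intro: finite_subset)
    then show ?thesis by simp
  qed
  also have "\<dots> = card (SIGMA A:H. V - A)"
    using finH assms(1) by (subst card_SigmaI) auto
  also have "\<dots> \<le> card ?T"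
    by (rule card_inj_on_le[OF inj sub finT])
  also have "\<dots> = (\<Sum>C | C \<subseteq> V \<and> card C = s.
      card {v \<in> V - C. insert v C \<in> H} * card {v \<in> V - C. insert v C \<notin> H})"
    using assms(1) by (subst card_SigmaI) (auto simp: card_cartesian_product)
  finally show ?thesis .
qed

text \<open>Both sides count the pairs of a set in \<open>H\<close> and one of its elements;
  removing the element gives \<open>C\<close>.\<close>

lemma sum_degrees:
  fixes H :: "'a set set"
  assumes "finite V" and H: "H \<subseteq> {A. A \<subseteq> V \<and> card A = Suc s}"
  shows "(\<Sum>C | C \<subseteq> V \<and> card C = s. card {v \<in> V - C. insert v C \<in> H}) = Suc s * card H"
proof -
  let ?L = "SIGMA C:{C. C \<subseteq> V \<and> card C = s}. {v \<in> V - C. insert v C \<in> H}"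
  have finH: "finite H"
    by (rule finite_subset[OF H]) (simp add: assms(1))
  have fin: "finite A" if "A \<in> H" for A
    using that H assms(1) by (auto intro: finite_subset)
  have "bij_betw (\<lambda>(C, v). (insert v C, v)) ?L (SIGMA A:H. A)"
    by (rule bij_betw_byWitness[where f' = "\<lambda>(A, v). (A - {v}, v)"])
       (use H in \<open>auto simp: insert_absorb\<close>)
  then have "card ?L = card (SIGMA A:H. A)"
    by (rule bij_betw_same_card)
  also have "\<dots> = (\<Sum>A\<in>H. card A)"
    using finH fin by (subst card_SigmaI) auto
  also have "\<dots> = Suc s * card H"
    using H by (subst sum.cong[OF refl, of _ _ "\<lambda>_. Suc s"]) auto
  finally show ?thesis
    using assms(1) by (subst (asm) card_SigmaI) auto
qed

text \<open>
  The case of de Caen's theorem in which the forbidden complete hypergraph has one vertex more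
  than the edges. \<open>H\<close> consists of the sets outside \<open>S\<close>, and \<open>t\<close> is the average degree that \<open>H\<close>
  would have in the extremal case: replacing \<open>d (m - d)\<close> by its tangent \<open>t\<^sup>2 + (m - 2 t) d\<close>
  at \<open>t\<close> takes the place of the Cauchy-Schwarz inequality.
\<close>
lemma de_caen:
  fixes S :: "'a set set"
  assumes fin: "finite V" and "r \<ge> 1" "r \<le> card V"
    and S: "S \<subseteq> {A. A \<subseteq> V \<and> card A = r}"
    and K: "\<And>e. e \<subseteq> V \<Longrightarrow> card e = Suc r \<Longrightarrow> \<exists>A\<in>S. A \<subseteq> e"
  shows "real (card S) \<ge>
    (real (card V) - real r) / (real r * (real (card V) - real r + 1)) * real (card V choose r)"
proof -
  obtain s where s: "r = Suc s" using assms(2) by (cases r) auto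
  define n where "n = card V"
  define m where "m = real n - real s"
  define U where "U = {A. A \<subseteq> V \<and> card A = r}"
  define H where "H = U - S"
  define Cs where "Cs = {C. C \<subseteq> V \<and> card C = s}"
  define d where "d C = card {v \<in> V - C. insert v C \<in> H}" for C
  define M where "M = real (n choose s)"
  define N where "N = real (card H)"
  \<comment> \<open>The value comes from \<open>r * N / M\<close>: equality in the claim means
    \<open>N = (1 - (m - 1) / (r * m)) * (n choose r)\<close>, and
    \<open>m * M = r * (n choose r)\<close>.\<close>
  define t where "t = m - (m - 1) / r"
  have rn: "r \<le> n" and m1: "m \<ge> 1" using assms(3) s by (auto simp: n_def m_def)
  have r0: "real r > 0" using assms(2) by simp
  have rt: "real r * t = real r * m - m + 1"
    using r0 by (simp add: t_def field_simps)
  have "real r * t \<ge> 1"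
  proof -
    have "real r * m \<ge> 1 * m" using assms(2) m1 by (intro mult_right_mono) auto
    then show ?thesis using rt by simp
  qed
  then have t0: "t > 0"
    using r0 by (metis less_le_trans zero_less_mult_pos zero_less_one)
  have Hsub: "H \<subseteq> {A. A \<subseteq> V \<and> card A = Suc s}"
    by (auto simp: H_def U_def s)
  have K': "\<exists>A. A \<subseteq> e \<and> card A = Suc s \<and> A \<notin> H"
    if e: "e \<subseteq> V" "card e = Suc (Suc s)" for e
  proof -
    obtain A where A: "A \<in> S" "A \<subseteq> e"
      using K[OF e(1)] e(2) s by blast
    moreover have "card A = Suc s" "A \<notin> H"
      using A S by (auto simp: H_def s)
    ultimately show ?thesis by blast
  qed
  have le: "card H * (n - r) \<le>
      (\<Sum>C\<in>Cs. d C * card {v \<in> V - C. insert v C \<notin> H})"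
    unfolding Cs_def d_def n_def s by (rule card_mult_le_of_nbr[OF fin Hsub K'])
  have compl: "real (card {v \<in> V - C. insert v C \<notin> H}) = m - real (d C)" if "C \<in> Cs" for C
  proof -
    have C: "C \<subseteq> V" "card C = s" "finite C"
      using that fin by (auto simp: Cs_def intro: finite_subset)
    have "card (V - C) = d C + card {v \<in> V - C. insert v C \<notin> H}"
      unfolding d_def using fin
      by (subst card_Un_disjoint[symmetric]) (auto intro!: arg_cong[where f = card])
    moreover have "card (V - C) = n - s"
      using C by (simp add: card_Diff_subset n_def)
    moreover have "s \<le> n" using rn s by simp
    ultimately show ?thesis
      by (simp add: m_def)
  qed
  have sum_d: "(\<Sum>C\<in>Cs. real (d C)) = real r * N"
  proof -
    have "(\<Sum>C\<in>Cs. d C) = r * card H"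
      unfolding Cs_def d_def s by (rule sum_degrees[OF fin Hsub])
    then show ?thesis
      by (simp add: N_def flip: of_nat_sum of_nat_mult)
  qed
  have cardCs: "real (card Cs) = M"
    using fin by (simp add: Cs_def M_def n_def n_subsets)
  have "N * (m - 1) = real (card H * (n - r))"
    using rn s by (simp add: N_def m_def)
  also have "\<dots> \<le> (\<Sum>C\<in>Cs. real (d C * card {v \<in> V - C. insert v C \<notin> H}))"
    using le unfolding of_nat_sum[symmetric] of_nat_le_iff .
  also have "\<dots> = (\<Sum>C\<in>Cs. real (d C) * (m - real (d C)))"
    by (intro sum.cong) (simp_all only: of_nat_mult compl)
  also have "\<dots> \<le> (\<Sum>C\<in>Cs. t\<^sup>2 + (m - 2 * t) * real (d C))"
  proof (rule sum_mono)
    fix C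
    have "0 \<le> (real (d C) - t)\<^sup>2" by simp
    then show "real (d C) * (m - real (d C)) \<le> t\<^sup>2 + (m - 2 * t) * real (d C)"
      by (simp add: power2_eq_square algebra_simps)
  qed
  also have "\<dots> = M * t\<^sup>2 + (m - 2 * t) * (real r * N)"
    by (simp add: sum.distrib cardCs sum_distrib_left[symmetric] sum_d)
  finally have "N * (m - 1) \<le> M * t\<^sup>2 + m * real r * N - 2 * (real r * t) * N"
    by (simp add: algebra_simps)
  \<comment> \<open>By \<open>rt\<close>, the terms free of \<open>t\<close> add up to
    \<open>- r * t * N\<close>. A factor \<open>t\<close> is then common to both sides of the
    inequality, and cancelling it bounds the average degree \<open>r * N / M\<close> by
    \<open>t\<close>.\<close>
  moreover have "N * (m - 1) - m * real r * N + 2 * (real r * t) * N = t * (real r * N)"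
  proof -
    have "N * (m - 1) - m * real r * N + 2 * (real r * t) * N = (real r * t) * N"
      unfolding rt by (simp add: algebra_simps)
    then show ?thesis by simp
  qed
  ultimately have "t * (real r * N) \<le> t * (t * M)"
    by (simp add: power2_eq_square algebra_simps)
  then have rN: "real r * N \<le> t * M"
    using t0 by simp
  have choose: "m * M = real r * real (n choose r)"
  proof -
    have "Suc s * (n choose Suc s) = (n choose s) * (n - s)"
      using binomial_absorb_comp[of n s] binomial_absorption[of s n]
      by (cases n) (auto simp: mult.commute)
    then have "real (Suc s) * real (n choose Suc s) = real (n choose s) * real (n - s)"
      by (metis of_nat_mult)
    moreover have "real (n - s) = m" using rn s by (simp add: m_def)
    ultimately show ?thesis by (simp only: M_def s mult.commute)
  qed
  have finU: "finite U" using fin by (simp add: U_def)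
  have "card U = n choose r"
    using fin by (simp add: U_def n_def n_subsets)
  moreover have "card U = card S + card H"
    using S finU by (auto simp: H_def U_def card_Diff_subset finite_subset card_mono)
  ultimately have SN: "real (card S) = real (n choose r) - N"
    by (simp add: N_def)
  \<comment> \<open>The factor \<open>m\<close> turns \<open>M\<close> into
    \<open>n choose r\<close> by \<open>choose\<close>, and the factor \<open>r\<close> clears the
    denominator of \<open>t\<close> by \<open>rt\<close>; \<open>SN\<close> then passes from
    \<open>H\<close> to its complement \<open>S\<close>.\<close>
  have "m * (real r * (real r * N)) \<le> m * (real r * (t * M))"
    using rN m1 r0 by (intro mult_left_mono) auto
  also have "\<dots> = (real r * t) * (m * M)"
    by (simp add: mult_ac)
  also have "\<dots> = (real r * m - m + 1) * (real r * real (n choose r))"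
    by (simp only: rt choose)
  finally have "real r * (m * real r * N) \<le> real r * ((real r * m - m + 1) * real (n choose r))"
    by (simp add: mult_ac)
  then have "m * real r * N \<le> (real r * m - m + 1) * real (n choose r)"
    using r0 by simp
  then have "(m - 1) * real (n choose r) \<le> real (card S) * (real r * m)"
    by (simp add: SN algebra_simps)
  moreover have "real r * m > 0" using r0 m1 by simp
  ultimately have "(m - 1) / (real r * m) * real (n choose r) \<le> real (card S)"
    by (simp add: divide_simps)
  moreover have "m = real n - real r + 1" by (simp add: m_def s)
  ultimately show ?thesis
    by (simp add: n_def)
qed

section \<open>Neighbouring edges in semicycles and the use of maximality\<close>

text \<open>Consecutive windows share \<open>k - 1\<close> positions. Since window \<open>i\<close>
  has \<open>k\<close> elements, the list has no repetition there, so these positions carry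
  \<open>k - 1\<close> different vertices.\<close>

lemma window_Int_window:
  assumes "card (window k vs i) = k" and "j = Suc i \<or> i = Suc j"
  shows "\<exists>D. card D = k - 1 \<and> D \<subseteq> window k vs i \<and> D \<subseteq> window k vs j"
proof -
  have inj: "inj_on ((!) vs) {i..<i + k}"
    using assms(1) by (intro eq_card_imp_inj_on) (auto simp: window_def)
  define P where "P = {i..<i + k} \<inter> {j..<j + k}"
  have "P = (if j = Suc i then {j..<i + k} else {i..<j + k})"
    using assms(2) by (auto simp: P_def)
  then have "card P = k - 1"
    using assms(2) by auto
  moreover have "inj_on ((!) vs) P"
    using inj by (rule inj_on_subset) (auto simp: P_def)
  ultimately show ?thesis
    by (intro exI[of _ "(!) vs ` P"]) (auto simp: card_image window_def P_def)
qed

text \<open>There are at least two windows, so the window that equals \<open>e\<close> has one next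
  to it, and windows at different positions are different edges.\<close>

lemma semicycle_edge_neighbour:
  assumes "k \<ge> 2" and semi: "semicycle k V E" and "e \<in> E"
  shows "\<exists>f\<in>E. f \<noteq> e \<and> (\<exists>D. card D = k - 1 \<and> D \<subseteq> e \<and> D \<subseteq> f)"
proof -
  have unif: "uniform_hypergraph k V E" using semi by (simp add: semicycle_def)
  obtain vs where len: "k \<le> length vs" and inj: "inj_on (window k vs) {0..length vs - k}"
    and E: "E = window k vs ` {0..length vs - k}" and hl: "hd vs = last vs"
    using semi by (auto simp: semicycle_def generates_def)
  have card_E: "card f = k" if "f \<in> E" for f
    using unif that by (simp add: uniform_hypergraph_def)
  \<comment> \<open>A single window would contain the coinciding first and last entries at two
    different positions, as \<open>k \<ge> 2\<close>, and so have fewer than \<open>k\<close>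
    elements.\<close>
  have "length vs \<noteq> k"
  proof
    assume l: "length vs = k"
    have "card (window k vs 0) = k"
      using card_E E by auto
    then have "inj_on ((!) vs) {0..<k}"
      by (intro eq_card_imp_inj_on) (auto simp: window_def)
    moreover have "vs ! 0 = vs ! (k - 1)"
      using hl l assms(1) by (cases "vs = []") (auto simp: hd_conv_nth last_conv_nth)
    ultimately show False
      using assms(1) by (auto dest: inj_onD)
  qed
  obtain i where i: "i \<le> length vs - k" "e = window k vs i"
    using assms(3) E by auto
  \<comment> \<open>The neighbour is the predecessor, except that window 0 takes its
    successor.\<close>
  obtain j where j: "j \<le> length vs - k" "j = Suc i \<or> i = Suc j"
  proof (cases i)
    case 0
    then show ?thesis
      using that[of 1] len \<open>length vs \<noteq> k\<close> by auto
  next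
    case (Suc i')
    then show ?thesis
      using that[of i'] i by auto
  qed
  have "window k vs j \<noteq> e"
    using inj_onD[OF inj, of j i] i j by auto
  moreover have "window k vs j \<in> E"
    using j E by auto
  moreover have "\<exists>D. card D = k - 1 \<and> D \<subseteq> e \<and> D \<subseteq> window k vs j"
    unfolding i(2)
    by (rule window_Int_window) (use card_E[OF assms(3)] i(2) j(2) in auto)
  ultimately show ?thesis
    by blast
qed

lemma edge_maximal_hypertree_meets_shadow:
  assumes "k \<ge> 2" and maxE: "edge_maximal_hypertree k V E"
    and e: "e \<subseteq> V" "card e = k"
  shows "\<exists>D. card D = k - 1 \<and> D \<subseteq> e \<and> (\<exists>f\<in>E. D \<subseteq> f)"
proof (cases "e \<in> E")
  case True
  then show ?thesis
    using obtain_subset_with_card_n[of "k - 1" e] e(2) by (metis diff_le_self)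
next
  case False
  have unif: "uniform_hypergraph k V E" and conn: "chain_connected k V E"
    and free: "semicycle_free k V E"
    using maxE by (auto simp: edge_maximal_hypertree_def hypertree_def)
  have "uniform_hypergraph k V (E \<union> {e})"
    using unif e by (auto simp: uniform_hypergraph_def)
  \<comment> \<open>Adding an edge keeps all old chains, so only semicycle-freeness can
    fail.\<close>
  moreover have "chain_connected k V (E \<union> {e})"
    using conn unfolding chain_connected_def subhypergraph_def by (meson le_supI1)
  moreover have "\<not> hypertree k V (E \<union> {e})"
    using maxE e False by (auto simp: edge_maximal_hypertree_def)
  ultimately obtain V' E' where sub: "subhypergraph k V' E' V (E \<union> {e})"
    and semi: "semicycle k V' E'"
    by (auto simp: hypertree_def semicycle_free_def)
  have eE': "e \<in> E'"
  proof (rule ccontr)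
    assume "e \<notin> E'"
    then have "subhypergraph k V' E' V E"
      using sub by (auto simp: subhypergraph_def)
    then show False
      using free semi by (auto simp: semicycle_free_def)
  qed
  \<comment> \<open>As \<open>e\<close> is the only new edge, \<open>f \<noteq> e\<close> forces
    \<open>f\<close> into \<open>E\<close>, which puts \<open>D\<close> in the shadow of
    \<open>E\<close>.\<close>
  obtain f D where "f \<in> E'" "f \<noteq> e" "card D = k - 1" "D \<subseteq> e" "D \<subseteq> f"
    using semicycle_edge_neighbour[OF assms(1) semi eE'] by blast
  then show ?thesis
    using sub by (auto simp: subhypergraph_def)
qed

section \<open>Size of the shadow and the final bound\<close>

lemma card_shadow_le:
  assumes "finite E" and "\<And>e. e \<in> E \<Longrightarrow> finite e \<and> card e = k" and "k \<ge> 1"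
  shows "card (\<Union>e\<in>E. {D. D \<subseteq> e \<and> card D = k - 1}) \<le> k * card E"
proof -
  have "card (\<Union>e\<in>E. {D. D \<subseteq> e \<and> card D = k - 1}) \<le>
      (\<Sum>e\<in>E. card {D. D \<subseteq> e \<and> card D = k - 1})"
    by (rule card_UN_le[OF assms(1)])
  also have "\<dots> = (\<Sum>e\<in>E. k)"
    using assms(2,3) binomial_symmetric[of "k - 1" k]
    by (intro sum.cong) (auto simp: n_subsets)
  finally show ?thesis by (simp add: mult.commute)
qed

theorem theorem13:
  fixes V :: "'a set" and E :: "'a set set" and k n :: nat
  assumes "k \<ge> 2"
    and "edge_maximal_hypertree k V E"
    and "n = card V"
    and "n \<ge> k - 1"
  shows "real (card E) \<ge>
    1 / (real k * (real k - 1)) * ((real n - real k + 1) / (real n - real k + 2)) *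
    real (n choose (k - 1))"
proof -
  define S where "S = (\<Union>e\<in>E. {D. D \<subseteq> e \<and> card D = k - 1})"
  have unif: "uniform_hypergraph k V E"
    using assms(2) by (simp add: edge_maximal_hypertree_def hypertree_def)
  have fin: "finite V" using unif by (simp add: uniform_hypergraph_def)
  have edges: "e \<subseteq> V" "card e = k" if "e \<in> E" for e
    using unif that by (auto simp: uniform_hypergraph_def)
  have finE: "finite E"
    using fin edges(1) by (intro finite_subset[of E "Pow V"]) auto
  have S_le: "card S \<le> k * card E"
    unfolding S_def using finE edges fin assms(1)
    by (intro card_shadow_le) (auto intro: finite_subset)
  have meets: "\<exists>A\<in>S. A \<subseteq> e" if "e \<subseteq> V" "card e = Suc (k - 1)" for e
    using edge_maximal_hypertree_meets_shadow[OF assms(1,2), of e] that assms(1)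
    by (auto simp: S_def)
  \<comment> \<open>Here \<open>r = k - 1\<close>, so \<open>k \<ge> 2\<close> and
    \<open>n \<ge> k - 1\<close> are the two size conditions of \<open>de_caen\<close>. The
    remaining factor \<open>1 / k\<close> comes from \<open>S_le\<close>.\<close>
  have "real (card S) \<ge> (real (card V) - real (k - 1)) /
      (real (k - 1) * (real (card V) - real (k - 1) + 1)) * real (card V choose (k - 1))"
    using assms(1,3,4) edges(1) by (intro de_caen[OF fin _ _ _ meets]) (auto simp: S_def)
  moreover have "real (k - 1) = real k - 1" using assms(1) by simp
  ultimately have "(real n - real k + 1) / ((real k - 1) * (real n - real k + 2)) *
      real (n choose (k - 1)) \<le> real (card S)"
    by (simp add: assms(3) algebra_simps)
  also have "\<dots> \<le> real k * real (card E)"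
    using S_le by (metis of_nat_le_iff of_nat_mult)
  finally have "(real n - real k + 1) / ((real k - 1) * (real n - real k + 2)) *
      real (n choose (k - 1)) / real k \<le> real (card E)"
    using assms(1) by (subst pos_divide_le_eq) (auto simp only: mult.commute)
  then show ?thesis
    by (simp add: mult_ac)
qed

end
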